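(* Let $p\ge 3$ be an odd integer and let $G=(V,E)$ be a good finite hypergraph. Let $w_1\in \mathbf{Z}_p^{V}$ be an initial configuration that is not identically zero, and let $w_2\in\mathbf{Z}_p^{V}$ be a final configuration that is not the configuration all of whose entries equal $-1$. Then $w_2$ is reachable from $w_1$ if and only if the linear system $H(w_1,w_2,G)$ has a solution in $\mathbf{Z}_p$.
   Context: $\mathbf{Z}_p$ is the ring of integers modulo $p$. A hypergraph $G=(V,E)$ has a finite vertex set $V$ and a set $E$ of hyperedges, which are subsets of $V$. A hypergraph is called good if it is connected and every hyperedge $e\in E$ satisfies $|e|\ge 3$. Dynamics ($\mathbf{Z}_p$-annihilating walk on $G$): a state (configuration) is a vector $w\in\mathbf{Z}_p^{V}$. An allowed move from a state $w$ consists of choosing a vertex $v$ with $w[v]\ne 0$ and a hyperedge $e$ containing $v$, and then replacing $w[v]$ by $w[v]-1$ and $w[u]$ by $w[u]+1$ for every $u\in e\setminus\{v\}$ (all arithmetic mod $p$; other entries are unchanged). A state $w'$ is reachable from $w$ if it can be obtained from $w$ by a finite (possibly empty) sequence of allowed moves. The system $H(w_1,w_2,G)$ has unknowns $X_{e,v}\in\mathbf{Z}_p$, one for each pair consisting of a hyperedge $e$ and a vertex $v\in e$, and one equation for each vertex $v\in V$: $$\sum_{e\ni v}\ \sum_{u\in e,\,u\neq v} X_{e,u}\;-\;\sum_{e\ni v} X_{e,v}\;=\;w_2[v]-w_1[v]\pmod p .$$ *)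

theory Defs
  imports "HOL-Library.FuncSet" "HOL-Number_Theory.Cong"
begin

definition hypergraph :: "'v set \<Rightarrow> 'v set set \<Rightarrow> bool" where
  "hypergraph V E \<longleftrightarrow> finite V \<and> E \<subseteq> Pow V"

text \<open>Any two vertices are joined by a walk whose consecutive vertices share a hyperedge.\<close>

definition hypergraph_connected :: "'v set \<Rightarrow> 'v set set \<Rightarrow> bool" where
  "hypergraph_connected V E \<longleftrightarrow>
     (\<forall>u\<in>V. \<forall>v\<in>V. (u, v) \<in> {(x, y). \<exists>e\<in>E. x \<in> e \<and> y \<in> e}\<^sup>*)"

definition good_hypergraph :: "'v set \<Rightarrow> 'v set set \<Rightarrow> bool" where
  "good_hypergraph V E \<longleftrightarrow>
     hypergraph V E \<and> hypergraph_connected V E \<and> (\<forall>e\<in>E. card e \<ge> 3)"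

text \<open>The ring of integers modulo \<open>p\<close> is represented by the canonical residues
  \<open>{0..<p}\<close>. Configurations are extensional functions (\<open>undefined\<close> outside \<open>V\<close>), so that equality
  of functions is equality of configurations.\<close>

definition configs :: "int \<Rightarrow> 'v set \<Rightarrow> ('v \<Rightarrow> int) set" where
  "configs p V = (V \<rightarrow>\<^sub>E {0..<p})"

definition const_config :: "int \<Rightarrow> 'v set \<Rightarrow> int \<Rightarrow> 'v \<Rightarrow> int" where
  "const_config p V c = (\<lambda>v\<in>V. c mod p)"

definition apply_move :: "int \<Rightarrow> 'v set \<Rightarrow> 'v \<Rightarrow> ('v \<Rightarrow> int) \<Rightarrow> 'v \<Rightarrow> int" where
  "apply_move p e v w =
     (\<lambda>u. if u = v then (w u - 1) mod p
          else if u \<in> e then (w u + 1) mod p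
          else w u)"

inductive move :: "int \<Rightarrow> 'v set set \<Rightarrow> ('v \<Rightarrow> int) \<Rightarrow> ('v \<Rightarrow> int) \<Rightarrow> bool"
  for p E where
  "e \<in> E \<Longrightarrow> v \<in> e \<Longrightarrow> w v \<noteq> 0 \<Longrightarrow> move p E w (apply_move p e v w)"

definition reachable :: "int \<Rightarrow> 'v set set \<Rightarrow> ('v \<Rightarrow> int) \<Rightarrow> ('v \<Rightarrow> int) \<Rightarrow> bool" where
  "reachable p E w1 w2 \<longleftrightarrow> (move p E)\<^sup>*\<^sup>* w1 w2"

text \<open>\<open>X\<close> solves the linear system \<open>H(w1, w2, (V, E))\<close>; only the values \<open>X e v\<close> with
  \<open>v \<in> e \<in> E\<close> matter.\<close>

definition solves_H ::
  "int \<Rightarrow> 'v set \<Rightarrow> 'v set set \<Rightarrow> ('v \<Rightarrow> int) \<Rightarrow> ('v \<Rightarrow> int) \<Rightarrow> ('v set \<Rightarrow> 'v \<Rightarrow> int) \<Rightarrow> bool" where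
  "solves_H p V E w1 w2 X \<longleftrightarrow>
     (\<forall>e\<in>E. \<forall>v\<in>e. X e v \<in> {0..<p}) \<and>
     (\<forall>v\<in>V. [(\<Sum>e\<in>{e\<in>E. v \<in> e}. \<Sum>u\<in>e - {v}. X e u) - (\<Sum>e\<in>{e\<in>E. v \<in> e}. X e v)
              = w2 v - w1 v] (mod p))"

end

theory Submission
  imports Defs
begin

text \<open>
  On a single hyperedge \<open>e\<close>, firing \<open>u\<close> and \<open>v\<close> once each adds 2 to all other vertices of \<open>e\<close>
  and fixes \<open>u\<close> and \<open>v\<close>. If the value at \<open>u\<close> is neither 0 nor -1, one of the two orders is
  allowed, so this can be repeated; as \<open>p\<close> is odd, every constant can be added to
  \<open>e - {u, v}\<close>. Combining two such operations moves any amount between two vertices other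
  than \<open>u\<close>, so on \<open>e\<close> only the sum modulo \<open>gcd (card e - 2) p\<close> is invariant. Firing a vertex with
  value -1 makes its value -2, so such a pivot \<open>u\<close> is reachable from every nonzero state; the
  symmetry \<open>w \<mapsto> -1 - w\<close>, which reverses all moves, gives the corresponding statement for the target.

  If the sum is the only invariant on each of two intersecting vertex sets, then so it is on
  their union, with the gcd of the moduli. By connectedness this extends to all of \<open>V\<close>, and the
  linear system forces the resulting congruence between the sums.
\<close>

section \<open>Integer-valued states and time reversal\<close>

locale annihilating_walk =
  fixes p :: int and V :: "'v set" and E :: "'v set set"
  assumes p_ge: "p \<ge> 3" and odd_p: "odd p"
    and hyper: "hypergraph V E" and card_edge: "e \<in> E \<Longrightarrow> card e \<ge> 3"
begin

lemma finite_V: "finite V" and edge_subset: "e \<in> E \<Longrightarrow> e \<subseteq> V"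
  using hyper by (auto simp: hypergraph_def)

lemma finite_E: "finite E"
  using hyper by (meson finite_Pow_iff finite_subset hypergraph_def)

lemma finite_edge: "e \<in> E \<Longrightarrow> finite e"
  using finite_V edge_subset finite_subset by blast

lemma not_dvd_small: "\<not> p dvd 1" "\<not> p dvd 2" "\<not> p dvd - 1" "\<not> p dvd - 2"
  using p_ge zdvd_imp_le[of p 1] zdvd_imp_le[of p 2] by auto

text \<open>States are handled as arbitrary integer functions and reduced modulo \<open>p\<close> only when they are
  compared with \<^const>\<open>reachable\<close>.\<close>

definition residues :: "('v \<Rightarrow> int) \<Rightarrow> 'v \<Rightarrow> int" where
  "residues w = (\<lambda>v\<in>V. w v mod p)"

definition reaches :: "('v \<Rightarrow> int) \<Rightarrow> ('v \<Rightarrow> int) \<Rightarrow> bool" where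
  "reaches w w' \<longleftrightarrow> reachable p E (residues w) (residues w')"

definition fire :: "'v set \<Rightarrow> 'v \<Rightarrow> ('v \<Rightarrow> int) \<Rightarrow> 'v \<Rightarrow> int" where
  "fire e v w = (\<lambda>u. if u = v then w u - 1 else if u \<in> e then w u + 1 else w u)"

definition shift :: "'v \<Rightarrow> 'v \<Rightarrow> int \<Rightarrow> ('v \<Rightarrow> int) \<Rightarrow> 'v \<Rightarrow> int" where
  "shift x y t w = w(x := w x + t, y := w y - t)"

text \<open>This involution exchanges the values 0 and -1, hence also the excluded source and the
  excluded target.\<close>

definition complement :: "('v \<Rightarrow> int) \<Rightarrow> 'v \<Rightarrow> int" where
  "complement w = (\<lambda>v. - 1 - w v)"

lemma complement_complement [simp]: "complement (complement w) = w"
  by (simp add: complement_def)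

lemma residues_cong:
  assumes "\<And>v. v \<in> V \<Longrightarrow> p dvd w' v - w v"
  shows "residues w = residues w'"
proof -
  have "w v mod p = w' v mod p" if "v \<in> V" for v
    using assms[OF that] by (metis mod_eq_dvd_iff)
  then show ?thesis by (auto simp: residues_def)
qed

lemma residues_configs: "w \<in> configs p V \<Longrightarrow> residues w = w"
  by (rule ext) (auto simp: residues_def configs_def PiE_def extensional_def Pi_def)

lemma reaches_cong: "(\<And>v. v \<in> V \<Longrightarrow> p dvd w' v - w v) \<Longrightarrow> reaches w w'"
  unfolding reaches_def reachable_def using residues_cong[of w' w] by simp

lemma reaches_refl: "reaches w w"
  by (rule reaches_cong) simp

lemma reaches_trans [trans]: "reaches w w' \<Longrightarrow> reaches w' w'' \<Longrightarrow> reaches w w''"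
  unfolding reaches_def reachable_def by (rule rtranclp_trans)

lemma apply_move_residues:
  assumes "e \<in> E" "v \<in> e"
  shows "apply_move p e v (residues w) = residues (fire e v w)"
  using edge_subset[OF assms(1)] assms(2)
  by (auto simp: fun_eq_iff apply_move_def residues_def fire_def mod_simps)

lemma reaches_fire:
  assumes "e \<in> E" "v \<in> e" "\<not> p dvd w v"
  shows "reaches w (fire e v w)"
proof -
  have "residues w v \<noteq> 0"
    using assms edge_subset by (auto simp: residues_def)
  then have "move p E (residues w) (residues (fire e v w))"
    using move.intros[OF assms(1,2)] apply_move_residues[OF assms(1,2)] by metis
  then show ?thesis by (simp add: reaches_def reachable_def)
qed

text \<open>After firing \<open>v\<close> from \<open>z\<close>, the complement has value
  \<open>- z v\<close> at \<open>v\<close>, which is nonzero because the move was allowed. Firing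
  \<open>v\<close> again along the same hyperedge therefore is allowed, and it yields the complement
  of \<open>z\<close>.\<close>

lemma reaches_complement:
  assumes "reaches w w'"
  shows "reaches (complement w') (complement w)"
proof -
  have "(move p E)\<^sup>*\<^sup>* a b \<Longrightarrow> a = residues w \<Longrightarrow>
      \<exists>w'. b = residues w' \<and> reaches (complement w') (complement w)" for a b
  proof (induction rule: rtranclp_induct)
    case base
    then show ?case using reaches_refl by blast
  next
    case (step b c)
    then obtain z where z: "b = residues z" "reaches (complement z) (complement w)"
      by blast
    from step.hyps(2) obtain e v where ev: "e \<in> E" "v \<in> e" "residues z v \<noteq> 0"
      and c: "c = residues (fire e v z)"
      by cases (metis apply_move_residues z(1))
    have "v \<in> V" using ev edge_subset by blast
    then have "\<not> p dvd z v"
      using ev(3) by (auto simp: residues_def)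
    then have "reaches (complement (fire e v z)) (fire e v (complement (fire e v z)))"
      using ev by (intro reaches_fire) (auto simp: complement_def fire_def)
    also have "fire e v (complement (fire e v z)) = complement z"
      by (auto simp: complement_def fire_def)
    finally show ?case using c z(2) reaches_trans by blast
  qed
  then obtain z where z: "residues w' = residues z" "reaches (complement z) (complement w)"
    using assms unfolding reaches_def reachable_def by blast
  \<comment> \<open>The induction only produces some integer lift \<open>z\<close> of the final
    residues; it differs from \<open>w'\<close> by multiples of \<open>p\<close> on
    \<open>V\<close>.\<close>
  have "p dvd z v - w' v" if "v \<in> V" for v
    using z(1) that by (metis mod_eq_dvd_iff residues_def restrict_apply')
  then have "reaches (complement w') (complement z)"
    by (intro reaches_cong) (auto simp: complement_def dvd_diff_commute)
  then show ?thesis using z(2) reaches_trans by blast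
qed

lemma sum_shift:
  assumes "finite A" "x \<in> A" "y \<in> A" "x \<noteq> y"
  shows "sum (shift x y t w) A = sum w A"
proof -
  have "A = insert x (insert y (A - {x, y}))" using assms by auto
  then obtain B where B: "A = insert x (insert y B)" "x \<notin> B" "y \<notin> B" by blast
  have "finite B" using B assms by simp
  have "sum (shift x y t w) B = sum w B"
    using B by (intro sum.cong) (auto simp: shift_def)
  then show ?thesis using B assms \<open>finite B\<close> by (simp add: shift_def)
qed

lemma obtain_third:
  assumes "card A \<ge> 3"
  obtains z where "z \<in> A" "z \<noteq> x" "z \<noteq> y"
proof -
  have "\<not> A \<subseteq> {x, y}"
    using assms card_mono[of "{x, y}" A] card_insert_le_m1[of 2 "{y}" x] by force
  then show ?thesis using that by blast
qed

section \<open>A single hyperedge\<close>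

definition bump :: "'v set \<Rightarrow> int \<Rightarrow> ('v \<Rightarrow> int) \<Rightarrow> 'v \<Rightarrow> int" where
  "bump B t w = (\<lambda>v. if v \<in> B then w v + t else w v)"

text \<open>Firing \<open>u\<close> first raises \<open>v\<close> to \<open>w v + 1\<close>, so this
  order fails only if that is 0. In that case \<open>w v\<close> is -1 and \<open>v\<close> can go
  first; \<open>u\<close> then holds \<open>w u + 1\<close>, nonzero by assumption.\<close>

lemma reaches_bump2:
  assumes e: "e \<in> E" "u \<in> e" "v \<in> e" "u \<noteq> v"
    and u: "\<not> p dvd w u" "\<not> p dvd w u + 1"
  shows "reaches w (bump (e - {u, v}) 2 w)"
proof (cases "p dvd w v + 1")
  case False
  have "reaches w (fire e u w)" using e u by (intro reaches_fire) auto
  also have "reaches (fire e u w) (fire e v (fire e u w))"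
    using e False by (intro reaches_fire) (auto simp: fire_def)
  also have "fire e v (fire e u w) = bump (e - {u, v}) 2 w"
    using e by (auto simp: fun_eq_iff fire_def bump_def)
  finally show ?thesis .
next
  case True
  then have "\<not> p dvd w v"
    using not_dvd_small(1) dvd_add_right_iff by blast
  then have "reaches w (fire e v w)" using e by (intro reaches_fire) auto
  also have "reaches (fire e v w) (fire e u (fire e v w))"
    using e u by (intro reaches_fire) (auto simp: fire_def)
  also have "fire e u (fire e v w) = bump (e - {u, v}) 2 w"
    using e by (auto simp: fun_eq_iff fire_def bump_def)
  finally show ?thesis .
qed

lemma reaches_bump:
  assumes e: "e \<in> E" "u \<in> e" "v \<in> e" "u \<noteq> v"
    and u: "\<not> p dvd w u" "\<not> p dvd w u + 1"
  shows "reaches w (bump (e - {u, v}) t w)"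
proof -
  have even_bump: "reaches w (bump (e - {u, v}) (2 * int n) w)" for n
  proof (induction n)
    case 0
    show ?case by (rule reaches_cong) (simp add: bump_def)
  next
    case (Suc n)
    let ?w = "bump (e - {u, v}) (2 * int n) w"
    have "reaches ?w (bump (e - {u, v}) 2 ?w)"
      using e u by (intro reaches_bump2) (auto simp: bump_def)
    also have "bump (e - {u, v}) 2 ?w = bump (e - {u, v}) (2 * int (Suc n)) w"
      by (auto simp: fun_eq_iff bump_def)
    finally show ?case using Suc reaches_trans by blast
  qed
  obtain q where q: "p = 2 * q + 1" using odd_p by (auto elim: oddE)
  \<comment> \<open>Since \<open>2 * (q + 1) = p + 1\<close>, the factor \<open>q + 1\<close> is the
    inverse of 2, and \<open>n\<close> represents half of \<open>t\<close> modulo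
    \<open>p\<close>.\<close>
  define n where "n = nat ((t * (q + 1)) mod p)"
  have n: "int n = (t * (q + 1)) mod p" using p_ge by (simp add: n_def)
  have "p dvd t * (q + 1) - int n" unfolding n by (simp add: minus_mod_eq_mult_div)
  then have "p dvd t * p - 2 * (t * (q + 1) - int n)"
    by (rule dvd_diff[OF dvd_triv_right dvd_mult])
  also have "t * p - 2 * (t * (q + 1) - int n) = 2 * int n - t"
    by (simp add: q algebra_simps)
  finally have "reaches (bump (e - {u, v}) (2 * int n) w) (bump (e - {u, v}) t w)"
    by (intro reaches_cong) (auto simp: bump_def dvd_diff_commute)
  with even_bump show ?thesis using reaches_trans by blast
qed

lemma reaches_shift:
  assumes e: "e \<in> E" "u \<in> e" "x \<in> e" "y \<in> e" "u \<noteq> x" "u \<noteq> y" "x \<noteq> y"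
    and u: "\<not> p dvd w u" "\<not> p dvd w u + 1"
  shows "reaches w (shift x y t w)"
proof -
  \<comment> \<open>The two bumps cancel except at \<open>x\<close> and \<open>y\<close>. The value
    at \<open>u\<close> never changes, so \<open>u\<close> stays usable for the second one.\<close>
  let ?w = "bump (e - {u, y}) t w"
  have "reaches w ?w" using assms by (intro reaches_bump) auto
  also have "reaches ?w (bump (e - {u, x}) (- t) ?w)"
    using assms by (intro reaches_bump) (auto simp: bump_def)
  also have "bump (e - {u, x}) (- t) ?w = shift x y t w"
    using e by (auto simp: fun_eq_iff bump_def shift_def)
  finally show ?thesis .
qed

lemma reaches_balanced:
  assumes e: "e \<in> E" "u \<in> e"
    and u: "\<not> p dvd w1 u" "\<not> p dvd w1 u + 1"
    and eq: "w2 u = w1 u" "\<And>v. v \<notin> e \<Longrightarrow> w2 v = w1 v"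
    and bal: "p dvd sum w2 e - sum w1 e"
  shows "reaches w1 w2"
proof -
  obtain y where y: "y \<in> e" "y \<noteq> u" using obtain_third[OF card_edge[OF e(1)]] by metis
  define B where "B = e - {u, y}"
  have "finite B" using finite_edge[OF e(1)] by (simp add: B_def)
  \<comment> \<open>The vertices of \<open>B\<close> are corrected one at a time by shifts against
    \<open>y\<close>, which serves as a reservoir and keeps the sum fixed.\<close>
  have *: "\<exists>w. reaches w1 w \<and> sum w e = sum w1 e \<and> (\<forall>v. v \<notin> insert y C \<longrightarrow> w v = w1 v)
      \<and> (\<forall>v\<in>C. w v = w2 v)" if "C \<subseteq> B" for C
    using finite_subset[OF that \<open>finite B\<close>] that
  proof (induction C rule: finite_induct)
    case empty
    show ?case using reaches_refl by blast
  next
    case (insert x C)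
    then obtain w where w: "reaches w1 w" "sum w e = sum w1 e"
      "\<forall>v. v \<notin> insert y C \<longrightarrow> w v = w1 v" "\<forall>v\<in>C. w v = w2 v"
      by auto
    have x: "x \<in> e" "x \<noteq> u" "x \<noteq> y" using insert by (auto simp: B_def)
    have "w u = w1 u" using w insert y by (auto simp: B_def)
    then have "reaches w (shift x y (w2 x - w x) w)"
      using reaches_shift e u x y by metis
    moreover have "sum (shift x y (w2 x - w x) w) e = sum w1 e"
      using sum_shift finite_edge e x y w by metis
    moreover have "shift x y (w2 x - w x) w v = w1 v" if "v \<notin> insert y (insert x C)" for v
      using that w by (simp add: shift_def)
    moreover have "shift x y (w2 x - w x) w v = w2 v" if "v \<in> insert x C" for v
      using that w x insert by (auto simp: shift_def B_def)
    ultimately show ?case using w(1) reaches_trans by blast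
  qed
  obtain w where w: "reaches w1 w" "sum w e = sum w1 e"
      "\<forall>v. v \<notin> insert y B \<longrightarrow> w v = w1 v" "\<forall>v\<in>B. w v = w2 v"
    using *[of B] by auto
  have others: "w v = w2 v" if "v \<noteq> y" for v
    using that w eq by (cases "v \<in> e") (auto simp: B_def)
  then have "sum w (e - {y}) = sum w2 (e - {y})" by (intro sum.cong) auto
  then have "w2 y - w y = sum w2 e - sum w1 e"
    using w(2) y finite_edge[OF e(1)] by (simp add: sum.remove)
  \<comment> \<open>Only \<open>y\<close> may still be wrong, and its error is the difference of the
    sums, a multiple of \<open>p\<close>.\<close>
  then have "reaches w w2"
    using bal others by (intro reaches_cong) (metis diff_self dvd_0_right)
  then show ?thesis using w reaches_trans by blast
qed

lemma reaches_pivot: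
  assumes e: "e \<in> E" "u \<in> e"
    and u: "\<not> p dvd w1 u" "\<not> p dvd w1 u + 1"
    and eq: "w2 u = w1 u" "\<And>v. v \<notin> e \<Longrightarrow> w2 v = w1 v"
    and dvd: "gcd (int (card e) - 2) p dvd sum w2 e - sum w1 e"
  shows "reaches w1 w2"
proof -
  obtain y where y: "y \<in> e" "y \<noteq> u" using obtain_third[OF card_edge[OF e(1)]] by metis
  obtain a b where "gcd (int (card e) - 2) p = a * (int (card e) - 2) + b * p"
    using bezout_int by metis
  then obtain c where c: "sum w2 e - sum w1 e = (a * (int (card e) - 2) + b * p) * c"
    using dvd by (auto elim: dvdE)
  \<comment> \<open>The bump acts on \<open>card e - 2\<close> vertices, so this amount supplies the
    first Bezout term; the second is a multiple of \<open>p\<close>.\<close>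
  let ?w = "bump (e - {u, y}) (a * c) w1"
  have "reaches w1 ?w" using e u y by (intro reaches_bump) auto
  also have "reaches ?w w2"
  proof (rule reaches_balanced[OF e])
    have "sum ?w e = (\<Sum>v\<in>e. w1 v + (if v \<in> e - {u, y} then a * c else 0))"
      by (intro sum.cong) (auto simp: bump_def)
    also have "\<dots> = sum w1 e + (\<Sum>v\<in>e - {u, y}. a * c)"
      using finite_edge[OF e(1)] by (simp add: sum.distrib sum.If_cases Int_def set_diff_eq)
    also have "(\<Sum>v\<in>e - {u, y}. a * c) = (int (card e) - 2) * (a * c)"
      using e y card_edge[OF e(1)] finite_edge[OF e(1)] by (simp add: card_Diff_subset of_nat_diff)
    finally have "sum w2 e - sum ?w e = p * (b * c)"
      using c by (simp add: algebra_simps)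
    then show "p dvd sum w2 e - sum ?w e" by simp
  qed (use u eq in \<open>auto simp: bump_def\<close>)
  finally show ?thesis .
qed

lemma reaches_between_pivots:
  assumes e: "e \<in> E" "u \<in> e" "v \<in> e"
    and u: "\<not> p dvd w1 u" "\<not> p dvd w1 u + 1"
    and v: "\<not> p dvd w2 v" "\<not> p dvd w2 v + 1"
    and eq: "\<And>v. v \<notin> e \<Longrightarrow> w2 v = w1 v"
    and dvd: "gcd (int (card e) - 2) p dvd sum w2 e - sum w1 e"
  shows "reaches w1 w2"
proof -
  have distinct: "reaches w w2"
    if x: "x \<in> e" "x \<noteq> v" "\<not> p dvd w x" "\<not> p dvd w x + 1"
      and w: "\<And>v. v \<notin> e \<Longrightarrow> w2 v = w v" "sum w e = sum w1 e" for w x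
  proof -
    obtain y where y: "y \<in> e" "y \<noteq> x" "y \<noteq> v"
      using obtain_third[OF card_edge[OF e(1)]] by metis
    \<comment> \<open>The intermediate state agrees with \<open>w\<close> at \<open>x\<close> and
      with \<open>w2\<close> at \<open>v\<close>, so each half of the walk keeps its own pivot
      fixed; \<open>y\<close> balances the sum.\<close>
    let ?m = "shift x y (w x - w2 x) w2"
    have sum: "sum ?m e = sum w2 e" using sum_shift finite_edge e x y by metis
    have "reaches w ?m"
      using e x y w sum dvd by (intro reaches_pivot[of e x]) (auto simp: shift_def)
    also have "reaches ?m w2"
      using e x y v sum by (intro reaches_pivot[of e v]) (auto simp: shift_def)
    finally show ?thesis .
  qed
  show ?thesis
  proof (cases "u = v")
    case False
    then show ?thesis using distinct e u eq by blast
  next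
    case True
    obtain x where x: "x \<in> e" "x \<noteq> u" using obtain_third[OF card_edge[OF e(1)]] by metis
    obtain y where y: "y \<in> e" "y \<noteq> u" "y \<noteq> x"
      using obtain_third[OF card_edge[OF e(1)]] by metis
    \<comment> \<open>When the pivots coincide, the source pivot is moved to \<open>x\<close> by
      giving it the value 1, which is neither 0 nor -1 modulo \<open>p\<close>.\<close>
    let ?m = "shift x y (1 - w1 x) w1"
    have "reaches w1 ?m" using e u x y by (intro reaches_shift) auto
    also have "reaches ?m w2"
      using True e eq x y not_dvd_small
      by (intro distinct[of x] sum_shift finite_edge) (auto simp: shift_def)
    finally show ?thesis .
  qed
qed

lemma reaches_to_pivot:
  assumes e: "e \<in> E" and w: "v \<in> e" "\<not> p dvd w v"
  obtains w' u where "reaches w w'" "u \<in> e" "\<not> p dvd w' u" "\<not> p dvd w' u + 1"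
    "\<And>v. v \<notin> e \<Longrightarrow> w' v = w v"
    "gcd (int (card e) - 2) p dvd sum w' e - sum w e"
proof (cases "p dvd w v + 1")
  case False
  then show ?thesis using that[of w v] w reaches_refl by simp
next
  case True
  let ?w = "fire e v w"
  have "?w v = (w v + 1) - 2" "?w v + 1 = (w v + 1) - 1" by (simp_all add: fire_def)
  then have "\<not> p dvd ?w v" "\<not> p dvd ?w v + 1"
    using True not_dvd_small by (metis dvd_diff_right_iff)+
  \<comment> \<open>The firing adds 1 at \<open>card e - 1\<close> vertices and removes 1 at
    \<open>v\<close>, so the sum changes by a multiple of the modulus.\<close>
  moreover have "sum ?w e - sum w e = int (card e) - 2"
  proof -
    have "sum ?w (e - {v}) = (\<Sum>u\<in>e - {v}. w u + 1)" by (intro sum.cong) (auto simp: fire_def)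
    also have "\<dots> = sum w (e - {v}) + int (card e - 1)"
      using w finite_edge[OF e] by (simp add: sum.distrib)
    finally have "sum ?w (e - {v}) = sum w (e - {v}) + int (card e - 1)" .
    moreover have "?w v = w v - 1" by (simp add: fire_def)
    ultimately show ?thesis
      using w card_edge[OF e] finite_edge[OF e] by (simp add: sum.remove of_nat_diff)
  qed
  moreover have "?w x = w x" if "x \<notin> e" for x
    using that w by (auto simp: fire_def)
  ultimately show ?thesis
    using that[OF reaches_fire[where w = w, OF e w] w(1)] by simp
qed

section \<open>Sets of vertices on which the sum is the only invariant\<close>

text \<open>Only the end states must agree outside \<open>A\<close>; the walk between them may leave
  \<open>A\<close>. Reversal by \<open>complement\<close> interchanges the two conditions modulo
  \<open>p\<close>.\<close>

definition controls :: "'v set \<Rightarrow> int \<Rightarrow> bool" where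
  "controls A g \<longleftrightarrow> (\<forall>w1 w2. (\<forall>v. v \<notin> A \<longrightarrow> w2 v = w1 v) \<longrightarrow> (\<exists>v\<in>A. \<not> p dvd w1 v) \<longrightarrow>
     (\<exists>v\<in>A. \<not> p dvd w2 v + 1) \<longrightarrow> g dvd sum w2 A - sum w1 A \<longrightarrow> reaches w1 w2)"

lemma controlsD:
  assumes "controls A g" "\<And>v. v \<notin> A \<Longrightarrow> w2 v = w1 v" "x \<in> A" "\<not> p dvd w1 x"
    "y \<in> A" "\<not> p dvd w2 y + 1" "g dvd sum w2 A - sum w1 A"
  shows "reaches w1 w2"
  using assms unfolding controls_def by blast

text \<open>A pivot is created forwards from \<open>w1\<close> and, through
  \<open>complement\<close>, backwards from \<open>w2\<close>. Being neither 0 nor -1 is preserved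
  by \<open>complement\<close>, so what remains is a walk between two states with pivots.\<close>

lemma controls_edge:
  assumes e: "e \<in> E"
  shows "controls e (gcd (int (card e) - 2) p)"
  unfolding controls_def
proof (intro allI impI)
  fix w1 w2 :: "'v \<Rightarrow> int"
  let ?g = "gcd (int (card e) - 2) p"
  assume eq: "\<forall>v. v \<notin> e \<longrightarrow> w2 v = w1 v" and w1: "\<exists>v\<in>e. \<not> p dvd w1 v"
    and w2: "\<exists>v\<in>e. \<not> p dvd w2 v + 1" and dvd: "?g dvd sum w2 e - sum w1 e"
  obtain z1 u1 where z1: "reaches w1 z1" "u1 \<in> e" "\<not> p dvd z1 u1" "\<not> p dvd z1 u1 + 1"
      "\<And>v. v \<notin> e \<Longrightarrow> z1 v = w1 v" "?g dvd sum z1 e - sum w1 e"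
    using w1 reaches_to_pivot[OF e] by metis
  have "\<exists>v\<in>e. \<not> p dvd complement w2 v"
    using w2 by (metis add.inverse_inverse add_uminus_conv_diff complement_def dvd_minus_iff
        minus_add_distrib add.commute)
  then obtain z2 u2 where z2: "reaches (complement w2) z2" "u2 \<in> e" "\<not> p dvd z2 u2"
      "\<not> p dvd z2 u2 + 1" "\<And>v. v \<notin> e \<Longrightarrow> z2 v = complement w2 v"
      "?g dvd sum z2 e - sum (complement w2) e"
    using reaches_to_pivot[OF e] by metis
  have "reaches (complement z2) w2" using reaches_complement[OF z2(1)] by simp
  moreover have "reaches z1 (complement z2)"
  proof (rule reaches_between_pivots[where u = u1 and v = u2 and ?w1.0 = z1, OF e z1(2) z2(2) z1(3,4)])
    have "complement z2 u2 = - (z2 u2 + 1)" "complement z2 u2 + 1 = - z2 u2"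
      by (simp_all add: complement_def)
    then show "\<not> p dvd complement z2 u2" "\<not> p dvd complement z2 u2 + 1"
      using z2(3,4) by (metis dvd_minus_iff)+
    show "complement z2 v = z1 v" if "v \<notin> e" for v
      using that z1(5) z2(5) eq by (simp add: complement_def)
    have "sum (complement z2) e - sum z1 e =
        (sum w2 e - sum w1 e) - (sum z1 e - sum w1 e) - (sum z2 e - sum (complement w2) e)"
      by (simp add: complement_def sum_subtractf)
    then show "?g dvd sum (complement z2) e - sum z1 e"
      using dvd z1(6) z2(6) by (metis dvd_diff)
  qed
  ultimately show "reaches w1 w2" using z1(1) reaches_trans by blast
qed

text \<open>The value 1 is wanted because it is both nonzero and different from -1. A third vertex
  of \<open>A\<close> absorbs the change of the sum.\<close>

lemma controls_spread:
  assumes A: "controls A g" "finite A" "card A \<ge> 3"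
    and w: "v \<in> A" "\<not> p dvd w v" and xy: "x \<in> A" "y \<in> A" "x \<noteq> y"
  obtains w' where "reaches w w'" "w' x = 1" "w' y = 1" "\<And>v. v \<notin> A \<Longrightarrow> w' v = w v"
    "sum w' A = sum w A"
proof -
  obtain z where z: "z \<in> A" "z \<noteq> x" "z \<noteq> y" using obtain_third[OF A(3)] by metis
  let ?w = "shift y z (1 - w y) (shift x z (1 - w x) w)"
  have 1: "?w x = 1" "?w y = 1" "\<And>v. v \<notin> A \<Longrightarrow> ?w v = w v"
    using xy z by (auto simp: shift_def)
  have 2: "sum ?w A = sum w A" using A xy z by (simp add: sum_shift)
  have "reaches w ?w"
    using 1 2 not_dvd_small xy w by (intro controlsD[OF A(1), where x = v and y = x]) auto
  then show ?thesis using that 1 2 by blast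
qed

lemma sum_eq_superset:
  fixes f g :: "'v \<Rightarrow> int"
  assumes "finite B" "A \<subseteq> B" "\<And>v. v \<notin> A \<Longrightarrow> f v = g v"
  shows "sum f B - sum g B = sum f A - sum g A"
proof -
  have "(\<Sum>v\<in>B. f v - g v) = (\<Sum>v\<in>A. f v - g v)"
    using assms by (intro sum.mono_neutral_right) auto
  then show ?thesis by (simp add: sum_subtractf)
qed

text \<open>If \<open>w\<close> vanishes on \<open>B\<close>, a nonzero value is first carried
  within \<open>A\<close> to the shared vertex \<open>x\<close>. Spreading inside \<open>B\<close>
  then sets both \<open>x\<close> and \<open>y\<close>.\<close>

lemma controls_activate:
  assumes A: "controls A g" "finite A" "card A \<ge> 3" and B: "controls B h" "finite B" "card B \<ge> 3"
    and x: "x \<in> A" "x \<in> B" and y: "y \<in> B" "y \<noteq> x"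
    and w: "\<exists>v\<in>A \<union> B. \<not> p dvd w v"
  obtains w' where "reaches w w'" "w' x = 1" "w' y = 1" "\<And>v. v \<notin> A \<union> B \<Longrightarrow> w' v = w v"
    "sum w' (A \<union> B) = sum w (A \<union> B)"
proof -
  obtain z where z: "reaches w z" "\<exists>v\<in>B. \<not> p dvd z v" "\<And>v. v \<notin> A \<union> B \<Longrightarrow> z v = w v"
    "sum z (A \<union> B) = sum w (A \<union> B)"
  proof (cases "\<exists>v\<in>B. \<not> p dvd w v")
    case True
    then show ?thesis using that[of w] reaches_refl by blast
  next
    case False
    then obtain v where v: "v \<in> A" "\<not> p dvd w v" using w by blast
    obtain x' where x': "x' \<in> A" "x' \<noteq> x" using obtain_third[OF A(3)] by metis
    obtain z where z: "reaches w z" "z x = 1" "\<And>v. v \<notin> A \<Longrightarrow> z v = w v" "sum z A = sum w A"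
      using controls_spread[where w = w, OF A v x(1) x'(1)] x'(2) by metis
    have "sum z (A \<union> B) = sum w (A \<union> B)"
      using sum_eq_superset[of "A \<union> B" A z w] A B z by simp
    then show ?thesis using that[of z] z x not_dvd_small by force
  qed
  then obtain v where "v \<in> B" "\<not> p dvd z v" by blast
  then obtain w' where w': "reaches z w'" "w' x = 1" "w' y = 1" "\<And>v. v \<notin> B \<Longrightarrow> w' v = z v"
    "sum w' B = sum z B"
    using controls_spread[where w = z, OF B _ _ x(2) y(1)] y(2) by metis
  have "sum w' (A \<union> B) = sum z (A \<union> B)"
    using sum_eq_superset[of "A \<union> B" B w' z] A B w' by simp
  then show ?thesis using that[of w'] z w' reaches_trans by auto
qed

text \<open>The walk goes through a state \<open>m\<close> that differs from \<open>w1\<close> on \<open>A\<close> and from \<open>w2\<close> on \<open>B\<close> only.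
  If \<open>A \<inter> B\<close> has a second vertex, a shift makes \<open>m\<close> equal to 1 at \<open>x\<close>; otherwise \<open>m\<close> agrees with
  \<open>w1\<close> at \<open>y\<close> and with \<open>w2\<close> at \<open>z\<close>.\<close>

lemma controls_join:
  assumes A: "controls A g" "finite A" and B: "controls B h" "finite B"
    and x: "x \<in> A" "x \<in> B" and yz: "y \<in> B" "y \<noteq> x" "z \<in> A" "z \<noteq> x"
    and w1: "\<not> p dvd w1 x" "\<not> p dvd w1 y" and w2: "\<not> p dvd w2 x + 1" "\<not> p dvd w2 z + 1"
    and eq: "\<And>v. v \<notin> A \<union> B \<Longrightarrow> w2 v = w1 v"
    and dvd: "gcd g h dvd sum w2 (A \<union> B) - sum w1 (A \<union> B)"
  shows "reaches w1 w2"
proof -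
  have via: "reaches w1 w2"
    if "\<And>v. v \<notin> A \<Longrightarrow> m v = w1 v" "\<And>v. v \<notin> B \<Longrightarrow> w2 v = m v"
      "g dvd sum m A - sum w1 A" "h dvd sum w2 B - sum m B"
      "a \<in> A" "\<not> p dvd m a + 1" "b \<in> B" "\<not> p dvd m b" for m a b
  proof -
    have "reaches w1 m" using that x w1 by (intro controlsD[OF A(1), where x = x and y = a]) auto
    also have "reaches m w2"
      using that x w2 by (intro controlsD[OF B(1), where x = b and y = x]) auto
    finally show ?thesis .
  qed
  \<comment> \<open>Bezout splits the required change of the sum into a multiple of
    \<open>g\<close>, realised within \<open>A\<close>, and a multiple of \<open>h\<close>, realised
    within \<open>B\<close>.\<close>
  obtain a b where "gcd g h = a * g + b * h" using bezout_int by metis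
  then obtain c where c: "sum w2 (A \<union> B) - sum w1 (A \<union> B) = (a * g + b * h) * c"
    using dvd by (auto elim: dvdE)
  define m0 where "m0 = (\<lambda>v. if v \<in> A - B then w2 v else w1 v)"
  \<comment> \<open>The sum over \<open>A\<close> is adjusted at \<open>x\<close>, which lies in
    both sets, so \<open>m\<close> keeps its agreement with \<open>w1\<close> off \<open>A\<close>
    and with \<open>w2\<close> off \<open>B\<close>.\<close>
  define m where "m = m0(x := m0 x + (a * g * c - (sum m0 A - sum w1 A)))"
  have m: "m v = w1 v" if "v \<notin> A" for v using that x by (auto simp: m_def m0_def)
  have m': "w2 v = m v" if "v \<notin> B" for v
    using that x eq by (auto simp: m_def m0_def)
  have "sum m (A - {x}) = sum m0 (A - {x})" by (intro sum.cong) (auto simp: m_def)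
  then have mA: "sum m A - sum w1 A = a * g * c"
    using A x by (simp add: sum.remove[of A x] m_def)
  have "sum w2 B - sum m B = sum w2 (A \<union> B) - sum m (A \<union> B)"
    using sum_eq_superset[of "A \<union> B" B w2 m] A B m' by simp
  moreover have "sum m A - sum w1 A = sum m (A \<union> B) - sum w1 (A \<union> B)"
    using sum_eq_superset[of "A \<union> B" A m w1] A B m by simp
  ultimately have mB: "sum w2 B - sum m B = b * h * c"
    using mA c by (simp add: algebra_simps)
  have two: "reaches w1 w2" if y': "y' \<in> A \<inter> B" "y' \<noteq> x" for y'
  proof (rule via[of "shift x y' (1 - m x) m"])
    show "g dvd sum (shift x y' (1 - m x) m) A - sum w1 A"
      using sum_shift[of A x y'] A x y' mA by auto
    show "h dvd sum w2 B - sum (shift x y' (1 - m x) m) B"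
      using sum_shift[of B x y'] B x y' mB by auto
  qed (use x y' m m' not_dvd_small in \<open>auto simp: shift_def\<close>)
  consider "y \<in> A" | "z \<in> B" | "y \<notin> A" "z \<notin> B" by blast
  then show ?thesis
  proof cases
    case 3
    show ?thesis
      by (rule via[of m z y]) (use m m' mA mB 3 yz w1 w2 in auto)
  qed (use two yz in auto)
qed

text \<open>The source is activated at \<open>x\<close> and \<open>y\<close>, the reversed target at
  \<open>x\<close> and \<open>z\<close> with \<open>A\<close> and \<open>B\<close> exchanged. The
  complement turns the latter values 1 into -2, which is not -1, as \<open>controls_join\<close>
  demands.\<close>

lemma controls_Un:
  assumes A: "controls A g" "finite A" "card A \<ge> 3" and B: "controls B h" "finite B" "card B \<ge> 3"
    and x: "x \<in> A" "x \<in> B"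
  shows "controls (A \<union> B) (gcd g h)"
  unfolding controls_def
proof (intro allI impI)
  fix w1 w2 :: "'v \<Rightarrow> int"
  assume eq: "\<forall>v. v \<notin> A \<union> B \<longrightarrow> w2 v = w1 v" and w1: "\<exists>v\<in>A \<union> B. \<not> p dvd w1 v"
    and w2: "\<exists>v\<in>A \<union> B. \<not> p dvd w2 v + 1"
    and dvd: "gcd g h dvd sum w2 (A \<union> B) - sum w1 (A \<union> B)"
  obtain y where y: "y \<in> B" "y \<noteq> x" using obtain_third[OF B(3)] by metis
  obtain z where z: "z \<in> A" "z \<noteq> x" using obtain_third[OF A(3)] by metis
  obtain w1' where w1': "reaches w1 w1'" "w1' x = 1" "w1' y = 1"
      "\<And>v. v \<notin> A \<union> B \<Longrightarrow> w1' v = w1 v" "sum w1' (A \<union> B) = sum w1 (A \<union> B)"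
    using controls_activate[OF A B x y w1] by metis
  have "\<exists>v\<in>B \<union> A. \<not> p dvd complement w2 v"
    using w2 by (metis add.inverse_inverse add_uminus_conv_diff complement_def dvd_minus_iff
        minus_add_distrib add.commute Un_commute)
  then obtain w2' where w2': "reaches (complement w2) w2'" "w2' x = 1" "w2' z = 1"
      "\<And>v. v \<notin> B \<union> A \<Longrightarrow> w2' v = complement w2 v"
      "sum w2' (B \<union> A) = sum (complement w2) (B \<union> A)"
    using controls_activate[OF B A x(2,1) z] by metis
  have "sum (complement w2') (A \<union> B) = sum w2 (A \<union> B)"
    using w2'(5) by (simp add: complement_def sum_subtractf Un_commute)
  then have "reaches w1' (complement w2')"
    using w1' w2' y z eq not_dvd_small dvd
    by (intro controls_join[OF A(1,2) B(1,2) x y z]) (auto simp: complement_def)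
  moreover have "reaches (complement w2') w2" using reaches_complement[OF w2'(1)] by simp
  ultimately show "reaches w1 w2" using w1'(1) reaches_trans by blast
qed

section \<open>From single hyperedges to the whole vertex set\<close>

definition edge_gcd :: "'v set set \<Rightarrow> int" where
  "edge_gcd F = Gcd (insert p ((\<lambda>e. int (card e) - 2) ` F))"

text \<open>A walk starting in the union cannot leave it: the hyperedge used by each step meets the
  union and hence belongs to \<open>F\<close>.\<close>

lemma Union_eq_V:
  assumes conn: "hypergraph_connected V E" and F: "F \<subseteq> E" "F \<noteq> {}"
    and closed: "\<And>e. e \<in> E \<Longrightarrow> e \<inter> \<Union>F \<noteq> {} \<Longrightarrow> e \<in> F"
  shows "\<Union>F = V"
proof
  show "\<Union>F \<subseteq> V" using F edge_subset by blast
  obtain f where f: "f \<in> F" using F by blast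
  then obtain u where u: "u \<in> f" using card_edge[of f] F by fastforce
  show "V \<subseteq> \<Union>F"
  proof
    fix v assume "v \<in> V"
    moreover have "u \<in> V" using f u F edge_subset by blast
    ultimately have "(u, v) \<in> {(x, y). \<exists>e\<in>E. x \<in> e \<and> y \<in> e}\<^sup>*"
      using conn by (simp add: hypergraph_connected_def)
    then show "v \<in> \<Union>F"
    proof (induction rule: rtrancl_induct)
      case base
      then show ?case using f u by blast
    next
      case (step a b)
      then show ?case using closed by blast
    qed
  qed
qed

lemma controls_V:
  assumes conn: "hypergraph_connected V E" and "E \<noteq> {}"
  shows "controls V (edge_gcd E)"
proof -
  \<comment> \<open>A maximal family in \<open>P\<close> contains every hyperedge meeting its union,
    since \<open>controls_Un\<close> would otherwise enlarge it. Connectedness then forces it to be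
    \<open>E\<close>.\<close>
  define P where "P = {F. F \<subseteq> E \<and> F \<noteq> {} \<and> controls (\<Union>F) (edge_gcd F)}"
  have "finite P" using finite_E by (auto simp: P_def)
  moreover obtain e where e: "e \<in> E" using \<open>E \<noteq> {}\<close> by blast
  then have "{e} \<in> P"
    using controls_edge[OF e] by (simp add: P_def edge_gcd_def gcd.commute)
  ultimately obtain F where F: "F \<in> P" and max: "\<And>F'. F' \<in> P \<Longrightarrow> F \<subseteq> F' \<Longrightarrow> F' = F"
    using finite_has_maximal2 by (metis (no_types, lifting))
  have FE: "F \<subseteq> E" "F \<noteq> {}" and FC: "controls (\<Union>F) (edge_gcd F)" using F by (auto simp: P_def)
  have fin: "finite (\<Union>F)" using FE edge_subset finite_V by (meson Sup_le_iff finite_subset subsetD)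
  obtain f where f: "f \<in> F" using FE by blast
  have card: "card (\<Union>F) \<ge> 3"
    using card_mono[OF fin, of f] card_edge[of f] f FE by fastforce
  have closed: "e \<in> F" if "e \<in> E" "e \<inter> \<Union>F \<noteq> {}" for e
  proof -
    from that(2) obtain x where "x \<in> \<Union>F" "x \<in> e" by blast
    then have "controls (\<Union>F \<union> e) (gcd (edge_gcd F) (gcd (int (card e) - 2) p))"
      using controls_Un[OF FC fin card controls_edge] that finite_edge card_edge by blast
    moreover have "gcd (edge_gcd F) (gcd (int (card e) - 2) p) = edge_gcd (insert e F)"
      by (simp add: edge_gcd_def gcd.commute gcd.left_commute gcd.assoc)
    ultimately have "insert e F \<in> P" using FE that by (simp add: P_def Un_commute)
    then show ?thesis using max[of "insert e F"] by blast
  qed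
  have V: "\<Union>F = V" using Union_eq_V[OF conn FE closed] .
  have "e \<in> F" if "e \<in> E" for e
  proof (rule closed[OF that])
    have "e \<noteq> {}" using card_edge[OF that] by auto
    then show "e \<inter> \<Union>F \<noteq> {}" using V edge_subset[OF that] by blast
  qed
  then have "F = E" using FE by blast
  then show ?thesis using FC V by simp
qed

section \<open>The linear system\<close>

text \<open>The left-hand side of the linear system: the net change at \<open>v\<close> when each
  vertex \<open>u\<close> of each hyperedge \<open>e\<close> is fired \<open>X e u\<close>
  times.\<close>

definition effect :: "('v set \<Rightarrow> 'v \<Rightarrow> int) \<Rightarrow> 'v \<Rightarrow> int" where
  "effect X v = (\<Sum>e\<in>{e\<in>E. v \<in> e}. \<Sum>u\<in>e - {v}. X e u) - (\<Sum>e\<in>{e\<in>E. v \<in> e}. X e v)"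

lemma effect_alt:
  "effect X v = (\<Sum>e\<in>E. if v \<in> e then (\<Sum>u\<in>e. X e u) - 2 * X e v else 0)"
proof -
  have "effect X v = (\<Sum>e\<in>{e\<in>E. v \<in> e}. (\<Sum>u\<in>e - {v}. X e u) - X e v)"
    by (simp add: effect_def sum_subtractf)
  also have "\<dots> = (\<Sum>e\<in>{e\<in>E. v \<in> e}. (\<Sum>u\<in>e. X e u) - 2 * X e v)"
    by (intro sum.cong) (auto simp: finite_edge sum.remove)
  also have "\<dots> = (\<Sum>e\<in>E. if v \<in> e then (\<Sum>u\<in>e. X e u) - 2 * X e v else 0)"
    using finite_E by (simp add: sum.inter_filter)
  finally show ?thesis .
qed

text \<open>Double counting: whichever vertex of \<open>e\<close> fires, the total over
  \<open>V\<close> changes by \<open>card e - 2\<close>.\<close>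

lemma sum_effect:
  "(\<Sum>v\<in>V. effect X v) = (\<Sum>e\<in>E. (int (card e) - 2) * (\<Sum>u\<in>e. X e u))"
proof -
  have "(\<Sum>v\<in>V. effect X v) =
      (\<Sum>e\<in>E. \<Sum>v\<in>V. if v \<in> e then (\<Sum>u\<in>e. X e u) - 2 * X e v else 0)"
    unfolding effect_alt by (rule sum.swap)
  also have "\<dots> = (\<Sum>e\<in>E. (int (card e) - 2) * (\<Sum>u\<in>e. X e u))"
  proof (intro sum.cong refl)
    fix e assume "e \<in> E"
    then have "V \<inter> e = e" using edge_subset by blast
    then have "(\<Sum>v\<in>V. if v \<in> e then (\<Sum>u\<in>e. X e u) - 2 * X e v else 0) =
        (\<Sum>v\<in>e. (\<Sum>u\<in>e. X e u) - 2 * X e v)"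
      using finite_V by (simp flip: sum.inter_restrict)
    also have "\<dots> = (int (card e) - 2) * (\<Sum>u\<in>e. X e u)"
      by (simp add: sum_subtractf algebra_simps flip: sum_distrib_left)
    finally show "(\<Sum>v\<in>V. if v \<in> e then (\<Sum>u\<in>e. X e u) - 2 * X e v else 0) =
        (int (card e) - 2) * (\<Sum>u\<in>e. X e u)" .
  qed
  finally show ?thesis .
qed

lemma effect_add: "effect (\<lambda>e v. X e v + Y e v) v = effect X v + effect Y v"
  unfolding effect_def by (simp add: sum.distrib)

lemma effect_cong_mod:
  assumes "\<And>e v. p dvd X e v - Y e v"
  shows "p dvd effect X v - effect Y v"
proof -
  have "effect X v - effect Y v = effect (\<lambda>e v. X e v - Y e v) v"
    unfolding effect_def by (simp add: sum_subtractf)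
  then show ?thesis using assms by (simp add: effect_def dvd_sum dvd_diff)
qed

lemma effect_single:
  assumes "e \<in> E" "v \<in> e"
  shows "effect (\<lambda>e' v'. if e' = e \<and> v' = v then 1 else 0) u = fire e v w u - w u"
proof -
  let ?X = "\<lambda>e' v'. if e' = e \<and> v' = v then 1 else 0 :: int"
  have "(if u \<in> e' then (\<Sum>x\<in>e'. ?X e' x) - 2 * ?X e' u else 0) =
      (if e' = e then fire e v w u - w u else 0)" if "e' \<in> E" for e'
    using assms finite_edge by (auto simp: fire_def)
  then have "effect ?X u = (\<Sum>e'\<in>E. if e' = e then fire e v w u - w u else 0)"
    unfolding effect_alt by (intro sum.cong refl)
  then show ?thesis using assms finite_E by simp
qed

text \<open>\<open>X\<close> counts the firings of each vertex along each hyperedge. On integer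
  lifts the equation is exact, and every move adds an indicator to \<open>X\<close>.\<close>

lemma reachable_effect:
  assumes "(move p E)\<^sup>*\<^sup>* (residues w) b"
  shows "\<exists>w' X. b = residues w' \<and> (\<forall>v. w' v - w v = effect X v)"
  using assms
proof (induction rule: rtranclp_induct)
  case base
  have "w v - w v = effect (\<lambda>e v. 0) v" for v by (simp add: effect_def)
  then show ?case by blast
next
  case (step b c)
  then obtain w' X where b: "b = residues w'" and X: "\<And>v. w' v - w v = effect X v" by blast
  from step.hyps(2) obtain e v where ev: "e \<in> E" "v \<in> e" and c: "c = residues (fire e v w')"
    by cases (metis apply_move_residues b)
  have "fire e v w' u - w u =
      effect (\<lambda>e' v'. X e' v' + (if e' = e \<and> v' = v then 1 else 0)) u" for u
    unfolding effect_add effect_single[OF ev, of u w'] X[of u, symmetric] by simp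
  then show ?case using c by blast
qed

lemma solves_H_iff:
  "solves_H p V E w1 w2 X \<longleftrightarrow>
    (\<forall>e\<in>E. \<forall>v\<in>e. X e v \<in> {0..<p}) \<and> (\<forall>v\<in>V. [effect X v = w2 v - w1 v] (mod p))"
  by (simp add: solves_H_def effect_def)

lemma reachable_imp_solvable:
  assumes "reachable p E w1 w2" "w1 \<in> configs p V" "w2 \<in> configs p V"
  shows "\<exists>X. solves_H p V E w1 w2 X"
proof -
  obtain w' X where w': "w2 = residues w'" and X: "\<And>v. w' v - w1 v = effect X v"
    using reachable_effect[of w1 w2] assms residues_configs by (auto simp: reachable_def)
  \<comment> \<open>A solution must consist of canonical residues; reducing the counts changes each
    effect by a multiple of \<open>p\<close>.\<close>
  have "[effect (\<lambda>e v. X e v mod p) v = w2 v - w1 v] (mod p)" if "v \<in> V" for v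
  proof -
    have "p dvd effect (\<lambda>e v. X e v mod p) v - effect X v"
      by (rule effect_cong_mod) (simp add: mod_eq_dvd_iff[symmetric])
    then have "[effect (\<lambda>e v. X e v mod p) v = w' v - w1 v] (mod p)"
      unfolding X by (simp add: cong_iff_dvd_diff)
    also have "[w' v - w1 v = w2 v - w1 v] (mod p)"
      using that by (simp add: w' residues_def cong_def mod_simps)
    finally show ?thesis .
  qed
  then show ?thesis using p_ge by (intro exI[of _ "\<lambda>e v. X e v mod p"]) (auto simp: solves_H_iff)
qed

text \<open>Summing all equations makes the difference of the sums congruent modulo \<open>p\<close>
  to a combination of the numbers \<open>card e - 2\<close>; \<open>edge_gcd E\<close> divides these
  and \<open>p\<close>.\<close>

lemma solvable_imp_edge_gcd_dvd:
  assumes "solves_H p V E w1 w2 X"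
  shows "edge_gcd E dvd sum w2 V - sum w1 V"
proof -
  have "[(\<Sum>v\<in>V. effect X v) = (\<Sum>v\<in>V. w2 v - w1 v)] (mod p)"
    using assms by (intro cong_sum) (simp add: solves_H_iff)
  then have "p dvd (sum w2 V - sum w1 V) - (\<Sum>v\<in>V. effect X v)"
    by (simp add: cong_iff_dvd_diff sum_subtractf dvd_diff_commute)
  moreover have "edge_gcd E dvd p" by (simp add: edge_gcd_def)
  moreover have "edge_gcd E dvd (\<Sum>v\<in>V. effect X v)"
    unfolding sum_effect edge_gcd_def by (intro dvd_sum dvd_mult2 Gcd_dvd) simp
  ultimately show ?thesis by (meson dvd_diff_left_iff dvd_trans)
qed

lemma solvable_imp_reachable:
  assumes conn: "hypergraph_connected V E" and X: "solves_H p V E w1 w2 X"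
    and w1: "w1 \<in> configs p V" "w1 \<noteq> const_config p V 0"
    and w2: "w2 \<in> configs p V" "w2 \<noteq> const_config p V (- 1)"
  shows "reachable p E w1 w2"
proof -
  have "reaches w1 w2"
  proof (cases "E = {}")
    case True
    \<comment> \<open>Without hyperedges all effects are empty sums, so the system itself says that
      the states agree modulo \<open>p\<close>.\<close>
    then have "[0 = w2 v - w1 v] (mod p)" if "v \<in> V" for v
      using X that True unfolding solves_H_iff effect_def by simp
    then show ?thesis
      by (intro reaches_cong) (simp add: cong_iff_dvd_diff dvd_diff_commute)
  next
    case False
    have not_const: "\<exists>v\<in>V. \<not> p dvd w v - c"
      if "w \<in> configs p V" "w \<noteq> const_config p V c" for w c
    proof (rule ccontr)
      assume "\<not> ?thesis"
      then have "residues w = residues (\<lambda>_. c)"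
        by (intro residues_cong) (auto simp: dvd_diff_commute)
      then show False
        using that residues_configs by (simp add: residues_def const_config_def)
    qed
    have "w2 v = w1 v" if "v \<notin> V" for v
      using that w1 w2 by (simp add: configs_def PiE_def extensional_def)
    moreover have "\<exists>v\<in>V. \<not> p dvd w1 v" "\<exists>v\<in>V. \<not> p dvd w2 v + 1"
      using not_const[OF w1] not_const[OF w2] by auto
    ultimately show ?thesis
      using controls_V[OF conn False] solvable_imp_edge_gcd_dvd[OF X]
      unfolding controls_def by blast
  qed
  then show ?thesis using w1 w2 residues_configs by (simp add: reaches_def)
qed

end

theorem theorem1:
  fixes p :: int and V :: "'v set" and E :: "'v set set" and w1 w2 :: "'v \<Rightarrow> int"
  assumes "p \<ge> 3" and "odd p"
    and "good_hypergraph V E"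
    and "w1 \<in> configs p V" and "w1 \<noteq> const_config p V 0"
    and "w2 \<in> configs p V" and "w2 \<noteq> const_config p V (- 1)"
  shows "reachable p E w1 w2 \<longleftrightarrow> (\<exists>X. solves_H p V E w1 w2 X)"
proof -
  interpret annihilating_walk p V E
    using assms(1-3) by unfold_locales (auto simp: good_hypergraph_def)
  have "hypergraph_connected V E" using assms(3) by (simp add: good_hypergraph_def)
  then show ?thesis
    using reachable_imp_solvable solvable_imp_reachable assms(4-7) by blast
qed

end
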